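(* For all integers $a$ and $d$ with $2\le a\le d+1$, if $n\ge 2a$, then $$H_{a,d}(n)\lesssim \sqrt{2an}.$$ In particular, $H_d(n)\lesssim\sqrt{2(d+1)n}$. Here $f(n)\lesssim g(n)$ means $f(n)\le (1+o(1))\,g(n)$, where the $o(1)$ term tends to $0$ as $n\to\infty$ with $a$ and $d$ fixed.
   Context: A $k$-flat is a $k$-dimensional affine subspace of $\mathbb{R}^d$. For integers $2\le a\le d+1$ and $n\ge 1$, $H_{a,d}(n)$ denotes the largest integer $t$ such that every set of $n$ points in $\mathbb{R}^d$ with no $a$ points lying on a common $(a-2)$-flat contains a subset of $t$ points for which all the $(a-1)$-dimensional simplices determined by the subset (one for each $a$-element subset of it, namely its convex hull) have pairwise distinct $(a-1)$-dimensional volumes. A finite set of at least $d+1$ points in $\mathbb{R}^d$ is in general position if no $d+1$ of its points lie on a common hyperplane. $H_d(n)$ denotes the largest integer $t$ such that every set of $n$ points in general position in $\mathbb{R}^d$ contains a subset of $t$ points all of whose $d$-dimensional simplices have pairwise distinct $d$-dimensional volumes; thus $H_d(n)=H_{d+1,d}(n)$. *)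

theory Defs
  imports "HOL-Analysis.Analysis"
begin

definition is_flat :: "nat \<Rightarrow> 'a::euclidean_space set \<Rightarrow> bool" where
  "is_flat k F \<longleftrightarrow> affine F \<and> aff_dim F = int k"

definition is_hyperplane :: "'a::euclidean_space set \<Rightarrow> bool" where
  "is_hyperplane F \<longleftrightarrow> (\<exists>u c. u \<noteq> 0 \<and> F = {x. u \<bullet> x = c})"

definition direction :: "'a::euclidean_space set \<Rightarrow> 'a set" where
  "direction S = span {x - y | x y. x \<in> S \<and> y \<in> S}"

definition orthonormal_basis :: "'a::euclidean_space set \<Rightarrow> 'a set \<Rightarrow> bool" where
  "orthonormal_basis B V \<longleftrightarrow> pairwise orthogonal B \<and> (\<forall>b\<in>B. norm b = 1) \<and> span B = V"

text \<open>
  The k-dimensional volume of a set spanning a k-flat is its Lebesgue measure inside that flat,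
  read off in orthonormal coordinates of the flat. By invariance of Lebesgue measure under
  isometries, neither the orthonormal basis chosen nor the origin of the flat matters (the
  coordinates below differ from coordinates relative to an origin in the flat by a translation).
  Sets spanning a flat of smaller dimension have volume 0; on sets spanning a flat of larger
  dimension the value 0 is a convention that is never used.
\<close>

definition volume :: "nat \<Rightarrow> 'a::euclidean_space set \<Rightarrow> real" where
  "volume k S =
     (if aff_dim S = int k
      then (let B = (SOME B. orthonormal_basis B (direction S))
            in measure (Pi\<^sub>M B (\<lambda>_. lborel)) ((\<lambda>x. \<lambda>b\<in>B. x \<bullet> b) ` S))
      else 0)"

definition distinct_volumes :: "nat \<Rightarrow> 'a::euclidean_space set \<Rightarrow> bool" where
  "distinct_volumes a Q \<longleftrightarrow>
     inj_on (\<lambda>A. volume (a - 1) (convex hull A)) {A. A \<subseteq> Q \<and> card A = a}"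

definition no_points_on_flat :: "nat \<Rightarrow> 'a::euclidean_space set \<Rightarrow> bool" where
  "no_points_on_flat a P \<longleftrightarrow>
     \<not> (\<exists>A F. A \<subseteq> P \<and> card A = a \<and> is_flat (a - 2) F \<and> A \<subseteq> F)"

definition general_position :: "'a::euclidean_space set \<Rightarrow> bool" where
  "general_position P \<longleftrightarrow> finite P \<and> card P \<ge> DIM('a) + 1 \<and>
     \<not> (\<exists>A F. A \<subseteq> P \<and> card A = DIM('a) + 1 \<and> is_hyperplane F \<and> A \<subseteq> F)"

text \<open>
  The ambient space is \<open>real ^ 'd\<close>, so the dimension enters through a type argument.
  The admissible \<open>t\<close> are bounded by \<open>n\<close> as soon as some admissible \<open>n\<close>-point set exists: this is
  the case for every \<open>n\<close> in \<open>H_flat\<close> when \<open>2 \<le> a \<le> CARD('d) + 1\<close>, and for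
  \<open>n \<ge> CARD('d) + 1\<close> in \<open>H_general\<close>.
\<close>

definition H_flat :: "'d::finite itself \<Rightarrow> nat \<Rightarrow> nat \<Rightarrow> nat" where
  "H_flat _ a n =
     (GREATEST t. \<forall>P :: (real ^ 'd) set.
        finite P \<and> card P = n \<and> no_points_on_flat a P \<longrightarrow>
        (\<exists>Q\<subseteq>P. card Q = t \<and> distinct_volumes a Q))"

definition H_general :: "'d::finite itself \<Rightarrow> nat \<Rightarrow> nat" where
  "H_general _ n =
     (GREATEST t. \<forall>P :: (real ^ 'd) set.
        card P = n \<and> general_position P \<longrightarrow>
        (\<exists>Q\<subseteq>P. card Q = t \<and> distinct_volumes (CARD('d) + 1) Q))"

end

(*
  Take the n points gamma(1), ..., gamma(n) of the moment curve of degree a - 1, lying in an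
  (a - 1)-dimensional coordinate subspace. For every s, the map gamma(t) |-> gamma(s - t) is the
  restriction of an affine involution of that subspace, which preserves (a - 1)-dimensional
  volumes because its determinant is 1 or -1. If a subset with distinct volumes contained more than
  a points that are swapped in pairs by one of these involutions, one could choose among them
  a-sets A and s - A that differ, which is impossible. So each of the at most 2n sums s accounts for
  at most a ordered pairs, and t(t - 1) <= 2an for a subset of t points.
*)
theory Submission
  imports Defs "HOL-Computational_Algebra.Polynomial"
begin

section \<open>Product Lebesgue measure in orthonormal coordinates\<close>

text \<open>The measure over \<open>I \<union> J\<close> is the image of the pair measure under
  \<open>merge I J\<close>, and the set in question pulls back to the rectangle
  \<open>X \<times> Y\<close>.\<close>

lemma emeasure_PiM_Un:
  assumes "product_sigma_finite M" "finite I" "finite J" "I \<inter> J = {}"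
    and X: "X \<in> sets (Pi\<^sub>M I M)" and Y: "Y \<in> sets (Pi\<^sub>M J M)"
  shows "emeasure (Pi\<^sub>M (I \<union> J) M)
      {f \<in> space (Pi\<^sub>M (I \<union> J) M). restrict f I \<in> X \<and> restrict f J \<in> Y}
    = emeasure (Pi\<^sub>M I M) X * emeasure (Pi\<^sub>M J M) Y"
proof -
  interpret product_sigma_finite M by fact
  interpret I: finite_product_sigma_finite M I by standard fact
  interpret J: finite_product_sigma_finite M J by standard fact
  let ?P = "Pi\<^sub>M I M \<Otimes>\<^sub>M Pi\<^sub>M J M" and ?U = "Pi\<^sub>M (I \<union> J) M"
  let ?E = "{f \<in> space ?U. restrict f I \<in> X \<and> restrict f J \<in> Y}"
  have E: "?E \<in> sets ?U"
  proof -
    have "?E = ((\<lambda>f. restrict f I) -` X \<inter> space ?U) \<inter> ((\<lambda>f. restrict f J) -` Y \<inter> space ?U)"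
      by auto
    moreover have "(\<lambda>f. restrict f I) \<in> measurable ?U (Pi\<^sub>M I M)"
      "(\<lambda>f. restrict f J) \<in> measurable ?U (Pi\<^sub>M J M)"
      by (auto intro!: measurable_restrict_subset)
    ultimately show ?thesis
      using X Y by (auto intro!: sets.Int measurable_sets)
  qed
  have "merge I J -` ?E \<inter> space ?P = X \<times> Y"
  proof (intro set_eqI iffI)
    fix p assume "p \<in> merge I J -` ?E \<inter> space ?P"
    then show "p \<in> X \<times> Y"
      using assms(4) by (cases p)
        (auto simp: space_pair_measure space_PiM PiE_def extensional_restrict)
  next
    fix p assume p: "p \<in> X \<times> Y"
    then have sp: "p \<in> space ?P"
      using sets.sets_into_space[OF X] sets.sets_into_space[OF Y]
      by (auto simp: space_pair_measure)
    then have "merge I J p \<in> space ?U"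
      using measurable_space[OF measurable_merge] by blast
    then show "p \<in> merge I J -` ?E \<inter> space ?P"
      using p sp assms(4) by (cases p)
        (auto simp: space_pair_measure space_PiM PiE_def extensional_restrict)
  qed
  then have "emeasure (distr ?P ?U (merge I J)) ?E = emeasure ?P (X \<times> Y)"
    using E by (simp add: emeasure_distr)
  then show ?thesis
    using assms by (simp add: distr_merge J.emeasure_pair_measure_Times)
qed

lemma sum_scaleR_inner_delta:
  fixes h :: "'i \<Rightarrow> 'a::real_inner"
  assumes "finite I" "i \<in> I" "\<And>j. j \<in> I \<Longrightarrow> h j \<bullet> v = (if j = i then 1 else 0)"
  shows "(\<Sum>j\<in>I. c j *\<^sub>R h j) \<bullet> v = c i"
proof -
  have "(\<Sum>j\<in>I. c j *\<^sub>R h j) \<bullet> v = (\<Sum>j\<in>I. if j = i then c j else 0)"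
    using assms(3) by (auto simp: inner_sum_left intro!: sum.cong)
  then show ?thesis using assms(1,2) by simp
qed

text \<open>Lebesgue measure is determined by its values on boxes, and in the coordinates labelled
  through \<open>h\<close> a box pulls back to a product of intervals.\<close>

lemma distr_PiM_lborel_Basis:
  fixes h :: "'i \<Rightarrow> 'a::euclidean_space"
  assumes I: "finite I" and h: "bij_betw h I Basis"
  shows "distr (Pi\<^sub>M I (\<lambda>_. lborel)) borel (\<lambda>f. \<Sum>i\<in>I. f i *\<^sub>R h i) = lborel"
proof (rule lborel_eqI[symmetric])
  interpret product_sigma_finite "\<lambda>_::'i. lborel :: real measure" by standard
  let ?M = "Pi\<^sub>M I (\<lambda>_. lborel :: real measure)" and ?F = "\<lambda>f. \<Sum>i\<in>I. f i *\<^sub>R h i"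
  have meas: "?F \<in> borel_measurable ?M"
    by measurable
  have hB: "h i \<in> Basis" if "i \<in> I" for i
    using h that by (auto simp: bij_betw_def)
  have coord: "?F f \<bullet> h i = f i" if "i \<in> I" for f i
    using I that h inner_Basis[OF hB hB]
    by (intro sum_scaleR_inner_delta) (auto simp: bij_betw_def inj_on_def)
  fix l u :: 'a assume le: "\<And>b. b \<in> Basis \<Longrightarrow> l \<bullet> b \<le> u \<bullet> b"
  have "?F -` box l u \<inter> space ?M = Pi\<^sub>E I (\<lambda>i. {l \<bullet> h i <..< u \<bullet> h i})"
  proof -
    have "?F f \<in> box l u \<longleftrightarrow> (\<forall>i\<in>I. l \<bullet> h i < f i \<and> f i < u \<bullet> h i)" for f
    proof -
      have "?F f \<in> box l u \<longleftrightarrow> (\<forall>b\<in>h ` I. l \<bullet> b < ?F f \<bullet> b \<and> ?F f \<bullet> b < u \<bullet> b)"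
        using h by (simp add: mem_box bij_betw_def)
      then show ?thesis using coord by simp
    qed
    then show ?thesis by (auto simp: space_PiM PiE_def Pi_def)
  qed
  then have "emeasure (distr ?M borel ?F) (box l u)
      = (\<Prod>i\<in>I. emeasure lborel {l \<bullet> h i <..< u \<bullet> h i})"
    using meas I by (simp add: emeasure_distr emeasure_PiM)
  also have "\<dots> = (\<Prod>i\<in>I. ennreal ((u - l) \<bullet> h i))"
    using le hB by (intro prod.cong) (auto simp: inner_diff_left)
  also have "\<dots> = (\<Prod>b\<in>Basis. ennreal ((u - l) \<bullet> b))"
    using h by (rule prod.reindex_bij_betw)
  also have "\<dots> = ennreal (\<Prod>b\<in>Basis. (u - l) \<bullet> b)"
    using le by (intro prod_ennreal) (auto simp: inner_diff_left)
  finally show "emeasure (distr ?M borel ?F) (box l u) = (\<Prod>b\<in>Basis. (u - l) \<bullet> b)" .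
qed simp

section \<open>Orthonormal bases of subspaces\<close>

lemma orthonormal_basis_exists:
  assumes "subspace V"
  obtains B where "orthonormal_basis B V"
  using orthonormal_basis_subspace[OF assms] unfolding orthonormal_basis_def by metis

lemma orthonormal_basis_inner:
  assumes "orthonormal_basis B V" "b \<in> B" "c \<in> B"
  shows "b \<bullet> c = (if b = c then 1 else 0)"
  using assms
  by (auto simp: orthonormal_basis_def pairwise_def orthogonal_def norm_eq_1)

lemma orthonormal_basis_independent:
  assumes "orthonormal_basis B V"
  shows "independent B"
  using assms pairwise_orthogonal_independent[of B]
  by (force simp: orthonormal_basis_def)

lemma orthonormal_basis_finite:
  assumes "orthonormal_basis B V"
  shows "finite B"
  using orthonormal_basis_independent[OF assms] by (rule independent_imp_finite)

lemma orthonormal_basis_sum: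
  assumes "orthonormal_basis B V" "x \<in> V"
  shows "(\<Sum>b\<in>B. (x \<bullet> b) *\<^sub>R b) = x"
  using assms orthonormal_basis_finite[OF assms(1)]
  by (intro orthonormal_basis_expand) (auto simp: orthonormal_basis_def)

lemma orthonormal_basis_Un_orthogonal_comp:
  assumes B: "orthonormal_basis B V" and C: "orthonormal_basis C (orthogonal_comp V)"
  shows "B \<inter> C = {}" "orthonormal_basis (B \<union> C) UNIV"
proof -
  have orth: "orthogonal b c" if "b \<in> B" "c \<in> C" for b c
  proof -
    have "b \<in> V" "c \<in> orthogonal_comp V"
      using that B C by (auto simp: orthonormal_basis_def span_base)
    then show ?thesis
      by (auto simp: orthogonal_comp_def)
  qed
  show "B \<inter> C = {}"
    using orth orthonormal_basis_inner[OF B] by (fastforce simp: orthogonal_def)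
  have "span (B \<union> C) = UNIV"
  proof -
    have V: "subspace V" using B by (auto simp: orthonormal_basis_def)
    have "x \<in> span (B \<union> C)" for x
    proof -
      obtain y z where "y \<in> span V" and z: "\<And>w. w \<in> span V \<Longrightarrow> orthogonal z w"
        and x: "x = y + z"
        using orthogonal_subspace_decomp_exists[of V x] by metis
      have "y \<in> span B" 
        using \<open>y \<in> span V\<close> B V by (simp add: orthonormal_basis_def span_eq_iff[THEN iffD2])
      moreover have "z \<in> span C"
        using z C by (auto simp: orthonormal_basis_def orthogonal_comp_def span_base orthogonal_commute)
      ultimately show ?thesis
        unfolding x by (metis Un_upper1 Un_upper2 in_mono span_add span_mono)
    qed
    then show ?thesis by auto
  qed
  moreover have "pairwise orthogonal (B \<union> C)"
    using B C orth unfolding orthonormal_basis_def pairwise_def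
    by (metis Un_iff orthogonal_commute)
  ultimately show "orthonormal_basis (B \<union> C) UNIV"
    using B C by (auto simp: orthonormal_basis_def)
qed

text \<open>The change of variables formula for linear maps is available only over a well-ordered
  finite index type, so we need one of each finite cardinality.\<close>

typedef (overloaded) ('n::finite) index = "{..<CARD('n)}"
  by (rule exI[of _ 0]) simp

lemma finite_UNIV_index: "finite (UNIV :: 'n::finite index set)"
  using type_definition.univ[OF type_definition_index[where 'n = 'n]]
  by (metis finite_imageI finite_lessThan)

lemma card_index: "CARD('n::finite index) = CARD('n)"
  using type_definition.card[OF type_definition_index[where 'n = 'n]] by simp

instance index :: (finite) finite
  by standard (rule finite_UNIV_index)

instantiation index :: (finite) wellorder
begin

definition less_eq_index :: "'a index \<Rightarrow> 'a index \<Rightarrow> bool" where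
  "x \<le> y \<longleftrightarrow> Rep_index x \<le> Rep_index y"

definition less_index :: "'a index \<Rightarrow> 'a index \<Rightarrow> bool" where
  "x < y \<longleftrightarrow> Rep_index x < Rep_index y"

instance
proof
  fix P :: "'a index \<Rightarrow> bool" and a
  assume step: "\<And>x. (\<And>y. y < x \<Longrightarrow> P y) \<Longrightarrow> P x"
  show "P a"
    by (induction a rule: measure_induct_rule[of Rep_index]) (auto intro: step simp: less_index_def)
qed (auto simp: less_eq_index_def less_index_def Rep_index_inject)

end

text \<open>\<open>K\<close> is a unit cube in the orthogonal complement: thickening a subset of \<open>V\<close> by it turns
  the measure inside \<open>V\<close> into a full-dimensional one.\<close>

lemma PiM_lborel_eq_lebesgue:
  fixes V :: "'a::euclidean_space set"
  assumes V: "subspace V" and B: "orthonormal_basis B V"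
    and dim: "DIM('a) = DIM('b::euclidean_space)"
  obtains G :: "'b::euclidean_space \<Rightarrow> 'a" and G' :: "'a \<Rightarrow> 'b" and K
  where "linear G" "linear G'" "\<And>x. G (G' x) = x" "\<And>x. G' (G x) = x"
    "compact K" "K \<subseteq> orthogonal_comp V"
    "\<And>S. compact S \<Longrightarrow> S \<subseteq> V \<Longrightarrow>
      measure (Pi\<^sub>M B (\<lambda>_. lborel)) ((\<lambda>x. \<lambda>b\<in>B. x \<bullet> b) ` S)
        = measure lebesgue (G' ` {x + y | x y. x \<in> S \<and> y \<in> K})"
proof -
  interpret product_sigma_finite "\<lambda>_::'a. lborel :: real measure" by standard
  let ?W = "orthogonal_comp V"
  obtain C where C: "orthonormal_basis C ?W"
    using orthonormal_basis_exists[OF subspace_orthogonal_comp] by blast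
  define D where "D = B \<union> C"
  note BC = orthonormal_basis_Un_orthogonal_comp[OF B C]
  have D: "orthonormal_basis D UNIV" using BC by (simp add: D_def)
  have fin: "finite B" "finite C" "finite D"
    using B C D orthonormal_basis_finite by blast+
  have orth: "b \<bullet> c = 0" if "b \<in> V" "c \<in> ?W" for b c
    using that by (auto simp: orthogonal_comp_def orthogonal_def)
  have BV: "b \<in> V" if "b \<in> B" for b
    using B that by (auto simp: orthonormal_basis_def span_base)
  have CW: "b \<in> ?W" if "b \<in> C" for b
    using C that by (auto simp: orthonormal_basis_def span_base)
  have "card D = card (Basis :: 'b set)"
    using D orthonormal_basis_independent[OF D] dim_eq_card[of D UNIV] dim
    by (simp add: orthonormal_basis_def)
  then obtain h where h: "bij_betw h D (Basis :: 'b set)"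
    using finite_same_card_bij[OF fin(3) finite_Basis] by metis
  define K where "K = {y \<in> ?W. \<forall>b\<in>C. 0 \<le> y \<bullet> b \<and> y \<bullet> b \<le> 1}"
  \<comment> \<open>\<open>G\<close> and \<open>G'\<close> are mutually inverse isometries that
    match the basis \<open>D\<close> with the standard basis of \<open>'b\<close> through
    \<open>h\<close>.\<close>
  define G where "G = (\<lambda>x. \<Sum>b\<in>D. (x \<bullet> h b) *\<^sub>R b)"
  define G' where "G' = (\<lambda>x. \<Sum>b\<in>D. (x \<bullet> b) *\<^sub>R h b)"
  have "linear G" "linear G'"
    unfolding G_def G'_def
    by (rule linearI; simp add: inner_add_left scaleR_add_left sum.distrib scaleR_sum_right)+
  have hinner: "h b \<bullet> h c = (if b = c then 1 else 0)" if "b \<in> D" "c \<in> D" for b c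
  proof -
    have "h b \<in> Basis" "h c \<in> Basis" "h b = h c \<longleftrightarrow> b = c"
      using h that by (auto simp: bij_betw_def inj_on_def)
    then show ?thesis by (simp add: inner_Basis)
  qed
  have coordG': "G' x \<bullet> h b = x \<bullet> b" if "b \<in> D" for x b
    unfolding G'_def using fin that by (intro sum_scaleR_inner_delta) (auto simp: hinner)
  have coordG: "G x \<bullet> b = x \<bullet> h b" if "b \<in> D" for x b
    unfolding G_def using fin that
    by (intro sum_scaleR_inner_delta) (auto simp: orthonormal_basis_inner[OF D])
  have GG': "G (G' x) = x" for x
    unfolding G_def using orthonormal_basis_sum[OF D, of x] by (simp add: coordG')
  have G'G: "G' (G x) = x" for x
  proof -
    have "G' (G x) = (\<Sum>b\<in>D. (x \<bullet> h b) *\<^sub>R h b)"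
      by (simp add: G'_def coordG)
    also have "\<dots> = (\<Sum>b\<in>Basis. (x \<bullet> b) *\<^sub>R b)"
      using h by (rule sum.reindex_bij_betw)
    finally show ?thesis by (simp add: euclidean_representation)
  qed
  have "compact K"
  proof -
    have "norm y \<le> card C" if "y \<in> K" for y
    proof -
      have "y = (\<Sum>b\<in>C. (y \<bullet> b) *\<^sub>R b)"
        using that orthonormal_basis_sum[OF C] by (simp add: K_def)
      also have "norm \<dots> \<le> (\<Sum>b\<in>C. norm ((y \<bullet> b) *\<^sub>R b))"
        by (rule norm_sum)
      also have "\<dots> \<le> (\<Sum>b\<in>C. 1)"
        using that C by (intro sum_mono) (auto simp: K_def orthonormal_basis_def)
      finally show ?thesis by simp
    qed
    then have "bounded K" by (auto simp: bounded_iff)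
    moreover have "closed K"
    proof -
      have "K = ?W \<inter> (\<Inter>b\<in>C. {y. 0 \<le> b \<bullet> y} \<inter> {y. b \<bullet> y \<le> 1})"
        by (auto simp: K_def inner_commute)
      moreover have "closed ?W"
        by (simp add: closed_subspace subspace_orthogonal_comp)
      ultimately show ?thesis
        by (auto intro!: closed_Int closed_INT closed_halfspace_le closed_halfspace_ge)
    qed
    ultimately show ?thesis by (simp add: compact_eq_bounded_closed)
  qed
  moreover have "measure (Pi\<^sub>M B (\<lambda>_. lborel)) ((\<lambda>x. \<lambda>b\<in>B. x \<bullet> b) ` S)
      = measure lebesgue (G' ` {x + y | x y. x \<in> S \<and> y \<in> K})"
    if S: "compact S" "S \<subseteq> V" for S
  proof -
    let ?Z = "{x + y | x y. x \<in> S \<and> y \<in> K}"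
    let ?X = "(\<lambda>x. \<lambda>b\<in>B. x \<bullet> b) ` S"
    let ?Y = "Pi\<^sub>E C (\<lambda>_. {0..1::real})"
    let ?M = "\<lambda>I. Pi\<^sub>M I (\<lambda>_::'a. lborel :: real measure)"
    let ?E = "{f \<in> space (?M D). restrict f B \<in> ?X \<and> restrict f C \<in> ?Y}"
    have "compact (G' ` ?Z)"
      using compact_sums[OF S(1) \<open>compact K\<close>] \<open>linear G'\<close>
      by (intro compact_continuous_image linear_continuous_on) (simp_all add: linear_linear)
    then have G'Z: "G' ` ?Z \<in> sets borel"
      by (simp add: borel_closed compact_imp_closed)
    have coordB: "(\<Sum>b\<in>B. f b *\<^sub>R b) \<bullet> c = f c" if "c \<in> B" for f c
      using fin that by (intro sum_scaleR_inner_delta) (auto simp: orthonormal_basis_inner[OF B])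
    have coordC: "(\<Sum>b\<in>C. f b *\<^sub>R b) \<bullet> c = f c" if "c \<in> C" for f c
      using fin that by (intro sum_scaleR_inner_delta) (auto simp: orthonormal_basis_inner[OF C])
    have sumV: "(\<Sum>b\<in>B. f b *\<^sub>R b) \<in> V" for f :: "'a \<Rightarrow> real"
      using V BV by (intro subspace_sum subspace_scale) auto
    have sumW: "(\<Sum>b\<in>C. f b *\<^sub>R b) \<in> ?W" for f :: "'a \<Rightarrow> real"
      using CW by (intro subspace_sum subspace_scale subspace_orthogonal_comp) auto
    \<comment> \<open>Reassembling a point of \<open>S\<close> from its coordinates recovers it
      because \<open>S \<subseteq> V\<close>. This exhibits \<open>?X\<close> as a preimage of
      \<open>S\<close>, which gives its measurability.\<close>
    have X: "f \<in> ?X \<longleftrightarrow> f \<in> space (?M B) \<and> (\<Sum>b\<in>B. f b *\<^sub>R b) \<in> S" for f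
    proof
      assume "f \<in> ?X"
      then obtain x where x: "x \<in> S" "f = (\<lambda>b\<in>B. x \<bullet> b)" by auto
      then have "(\<Sum>b\<in>B. f b *\<^sub>R b) = x"
        using orthonormal_basis_sum[OF B, of x] S by auto
      with x show "f \<in> space (?M B) \<and> (\<Sum>b\<in>B. f b *\<^sub>R b) \<in> S"
        by (simp add: space_PiM)
    next
      assume f: "f \<in> space (?M B) \<and> (\<Sum>b\<in>B. f b *\<^sub>R b) \<in> S"
      then have "f = (\<lambda>b\<in>B. (\<Sum>b\<in>B. f b *\<^sub>R b) \<bullet> b)"
        by (auto simp: space_PiM PiE_def extensional_def coordB fun_eq_iff)
      with f show "f \<in> ?X" by blast
    qed
    have Xsets: "?X \<in> sets (?M B)"
    proof -
      have "?X = (\<lambda>f. \<Sum>b\<in>B. f b *\<^sub>R b) -` S \<inter> space (?M B)"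
        using X by blast
      moreover have "(\<lambda>f. \<Sum>b\<in>B. f b *\<^sub>R b) \<in> borel_measurable (?M B)"
        by measurable
      moreover have "S \<in> sets borel"
        using S(1) by (simp add: borel_closed compact_imp_closed)
      ultimately show ?thesis
        by (simp only: measurable_sets)
    qed
    have Ysets: "?Y \<in> sets (?M C)"
      using fin by (intro sets_PiM_I_finite) auto
    \<comment> \<open>The unit cube contributes a factor 1, so the measure of \<open>?X\<close> is
      exactly that of the thickened set.\<close>
    have "emeasure (?M C) ?Y = 1"
      using fin by (simp add: emeasure_PiM)
    then have "emeasure (?M B) ?X = emeasure (?M D) ?E"
      unfolding D_def using emeasure_PiM_Un[OF product_sigma_finite_axioms fin(1,2) BC(1) Xsets Ysets]
      by simp
    also have "?E = (\<lambda>f. \<Sum>b\<in>D. f b *\<^sub>R h b) -` (G' ` ?Z) \<inter> space (?M D)"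
    proof -
      have "restrict f B \<in> ?X \<and> restrict f C \<in> ?Y \<longleftrightarrow> (\<Sum>b\<in>D. f b *\<^sub>R h b) \<in> G' ` ?Z" for f
      proof -
        let ?u = "\<Sum>b\<in>B. f b *\<^sub>R b" and ?w = "\<Sum>b\<in>C. f b *\<^sub>R b"
        have "G (\<Sum>b\<in>D. f b *\<^sub>R h b) = (\<Sum>c\<in>D. f c *\<^sub>R c)"
          unfolding G_def using fin
          by (intro sum.cong refl arg_cong2[where f = scaleR] sum_scaleR_inner_delta)
            (auto simp: hinner)
        also have "\<dots> = ?u + ?w"
          unfolding D_def using fin BC(1) by (simp add: sum.union_disjoint)
        finally have "(\<Sum>b\<in>D. f b *\<^sub>R h b) \<in> G' ` ?Z \<longleftrightarrow> ?u + ?w \<in> ?Z"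
          using GG' G'G by (metis (no_types, lifting) imageE imageI)
        also have "\<dots> \<longleftrightarrow> ?u \<in> S \<and> ?w \<in> K"
        proof
          assume "?u + ?w \<in> ?Z"
          then obtain x y where xy: "x \<in> S" "y \<in> K" "?u + ?w = x + y" by blast
          \<comment> \<open>The two sides lie in \<open>V\<close> and in its orthogonal complement,
            so their common value is orthogonal to itself and vanishes: the decomposition is
            unique.\<close>
          then have "?u - x = y - ?w" by (simp add: algebra_simps)
          moreover have "?u - x \<in> V"
            using sumV S xy V by (auto intro: subspace_diff)
          moreover have "y - ?w \<in> ?W"
            using sumW xy by (auto simp: K_def intro: subspace_diff subspace_orthogonal_comp)
          ultimately have "(?u - x) \<bullet> (?u - x) = 0" "(y - ?w) \<bullet> (y - ?w) = 0"
            using orth by metis+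
          with xy show "?u \<in> S \<and> ?w \<in> K" by simp
        qed auto
        also have "?w \<in> K \<longleftrightarrow> restrict f C \<in> ?Y"
          using sumW[of f] by (auto simp: K_def coordC PiE_iff)
        also have "?u \<in> S \<longleftrightarrow> restrict f B \<in> ?X"
          unfolding X by (simp add: space_PiM)
        finally show ?thesis by blast
      qed
      then show ?thesis
        by (simp only: set_eq_iff mem_Collect_eq Int_iff vimage_eq conj_commute simp_thms)
    qed
    also have "emeasure (?M D) \<dots> = emeasure lborel (G' ` ?Z)"
      unfolding distr_PiM_lborel_Basis[OF fin(3) h, symmetric] using G'Z
      by (subst emeasure_distr) auto
    also have "\<dots> = emeasure lebesgue (G' ` ?Z)"
      using G'Z by simp
    finally show ?thesis
      unfolding measure_def by (rule arg_cong)
  qed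
  ultimately show thesis
    using that[of G G' K] \<open>linear G\<close> \<open>linear G'\<close> GG' G'G K_def by blast
qed

section \<open>Volumes under affine involutions\<close>

text \<open>Taking determinants in \<open>f \<circ> f = id\<close> shows that the determinant
  squares to 1.\<close>

lemma abs_det_matrix_involution:
  fixes f :: "real ^ 'n \<Rightarrow> real ^ 'n"
  assumes "linear f" "\<And>x. f (f x) = x"
  shows "\<bar>det (matrix f)\<bar> = 1"
proof -
  have "f \<circ> f = id" using assms by auto
  then have "matrix f ** matrix f = mat 1"
    using matrix_compose[OF assms(1) assms(1)] by (simp add: matrix_id_mat_1)
  then have "det (matrix f) * det (matrix f) = 1"
    by (metis det_I det_mul)
  then have "\<bar>det (matrix f)\<bar>\<^sup>2 = 1" by (simp add: power2_eq_square)
  then show ?thesis by (auto simp: power2_eq_1_iff)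
qed

text \<open>Since \<open>f\<close> fixes the orthogonal complement pointwise, the affine map carries
  the thickening of \<open>S\<close> onto the thickening of its image. In full dimension,
  translation invariance and a determinant of absolute value 1 finish the argument.\<close>

lemma volume_affine_involution:
  fixes S :: "(real ^ 'n) set"
  assumes S: "compact S" "S \<subseteq> V" and V: "direction S = V"
    and f: "linear f" "\<And>x. f (f x) = x" "\<And>x. x \<in> V \<Longrightarrow> f x \<in> V"
      "\<And>x. x \<in> orthogonal_comp V \<Longrightarrow> f x = x"
    and v: "v \<in> V"
  shows "volume k ((\<lambda>x. v + f x) ` S) = volume k S"
proof -
  let ?T = "\<lambda>x. v + f x"
  have sV: "subspace V" using V by (auto simp: direction_def)
  have inj: "inj f" using f(2) by (metis injI)
  have im: "?T ` S = (+) v ` (f ` S)" by auto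
  have "f ` V = V"
    using f(2,3) by (metis image_subset_iff subset_antisym image_eqI subsetI)
  have "{x - y | x y. x \<in> ?T ` S \<and> y \<in> ?T ` S} = f ` {x - y | x y. x \<in> S \<and> y \<in> S}"
  proof (intro set_eqI iffI)
    fix z assume "z \<in> {x - y | x y. x \<in> ?T ` S \<and> y \<in> ?T ` S}"
    then obtain x y where "x \<in> S" "y \<in> S" "z = ?T x - ?T y" by blast
    then have "z = f (x - y)" by (simp add: linear_diff[OF f(1)])
    with \<open>x \<in> S\<close> \<open>y \<in> S\<close> show "z \<in> f ` {x - y | x y. x \<in> S \<and> y \<in> S}" by blast
  next
    fix z assume "z \<in> f ` {x - y | x y. x \<in> S \<and> y \<in> S}"
    then obtain x y where "x \<in> S" "y \<in> S" "z = f (x - y)" by blast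
    then have "z = ?T x - ?T y" by (simp add: linear_diff[OF f(1)])
    with \<open>x \<in> S\<close> \<open>y \<in> S\<close> show "z \<in> {x - y | x y. x \<in> ?T ` S \<and> y \<in> ?T ` S}" by blast
  qed
  \<comment> \<open>With equal directions, the choice made by \<open>SOME\<close> in
    \<open>volume\<close> yields the same basis for both sets, so one coordinate system serves
    both.\<close>
  then have dirT: "direction (?T ` S) = V"
    using V \<open>f ` V = V\<close> by (simp add: direction_def linear_span_image[OF f(1)])
  have dimT: "aff_dim (?T ` S) = aff_dim S"
    unfolding im by (simp add: aff_dim_translation_eq f(1) inj)
  have TS: "compact (?T ` S)" "?T ` S \<subseteq> V"
    using S f(1,3) v sV unfolding im
    by (auto intro!: compact_translation compact_continuous_image linear_continuous_on
        subspace_add simp: linear_linear)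
  define B where "B = (SOME B. orthonormal_basis B V)"
  have B: "orthonormal_basis B V"
    unfolding B_def using orthonormal_basis_exists[OF sV] by (metis someI_ex)
  have "DIM(real ^ 'n) = DIM(real ^ 'n index)"
    by (simp add: card_index)
  then obtain G :: "real ^ 'n index \<Rightarrow> real ^ 'n" and G' :: "real ^ 'n \<Rightarrow> real ^ 'n index" and K
  where G: "linear G" "linear G'" "\<And>x. G (G' x) = x" "\<And>x. G' (G x) = x"
    and K: "compact K" "K \<subseteq> orthogonal_comp V"
    and meas: "\<And>S. compact S \<Longrightarrow> S \<subseteq> V \<Longrightarrow>
      measure (Pi\<^sub>M B (\<lambda>_. lborel)) ((\<lambda>x. \<lambda>b\<in>B. x \<bullet> b) ` S)
        = measure lebesgue (G' ` {x + y | x y. x \<in> S \<and> y \<in> K})"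
    by (rule PiM_lborel_eq_lebesgue[OF sV B]) blast
  let ?Z = "{x + y | x y. x \<in> S \<and> y \<in> K}" and ?F = "\<lambda>x. G' (f (G x))"
  have "{x + y | x y. x \<in> ?T ` S \<and> y \<in> K} = (+) v ` f ` {x + y | x y. x \<in> S \<and> y \<in> K}"
  proof -
    have *: "(v + f x) + y = v + f (x + y)" if "y \<in> K" for x y
      using that K f(4) by (simp add: linear_add[OF f(1)] subset_iff)
    show ?thesis
    proof (intro set_eqI iffI)
      fix z assume "z \<in> {x + y | x y. x \<in> ?T ` S \<and> y \<in> K}"
      then obtain x y where xy: "x \<in> S" "y \<in> K" "z = (v + f x) + y" by blast
      then have "z = v + f (x + y)" using * by simp
      with xy show "z \<in> (+) v ` f ` {x + y | x y. x \<in> S \<and> y \<in> K}" by blast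
    next
      fix z assume "z \<in> (+) v ` f ` {x + y | x y. x \<in> S \<and> y \<in> K}"
      then obtain x y where xy: "x \<in> S" "y \<in> K" "z = v + f (x + y)" by blast
      then have "z = (v + f x) + y" using * by simp
      with xy show "z \<in> {x + y | x y. x \<in> ?T ` S \<and> y \<in> K}" by blast
    qed
  qed
  then have "G' ` {x + y | x y. x \<in> ?T ` S \<and> y \<in> K} = (+) (G' v) ` (?F ` (G' ` ?Z))"
    by (simp add: image_image linear_add[OF G(2)] G(3))
  moreover have "measure lebesgue (?F ` (G' ` ?Z)) = measure lebesgue (G' ` ?Z)"
  proof -
    \<comment> \<open>\<open>?F\<close> is \<open>f\<close> conjugated by \<open>G\<close>, hence
      again a linear involution.\<close>
    have lin: "linear ?F"
      using linear_compose[OF linear_compose[OF G(1) f(1)] G(2)] by (simp add: o_def)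
    have "compact (G' ` ?Z)"
      using compact_sums[OF S(1) K(1)] G(2)
      by (intro compact_continuous_image linear_continuous_on) (simp_all add: linear_linear)
    then show ?thesis
      using measure_linear_image[OF lin lmeasurable_compact]
        abs_det_matrix_involution[OF lin] by (simp add: G f(2))
  qed
  ultimately have "measure lebesgue (G' ` {x + y | x y. x \<in> ?T ` S \<and> y \<in> K})
      = measure lebesgue (G' ` ?Z)"
    by (simp add: measure_translation)
  then have "measure (Pi\<^sub>M B (\<lambda>_. lborel)) ((\<lambda>x. \<lambda>b\<in>B. x \<bullet> b) ` (?T ` S))
      = measure (Pi\<^sub>M B (\<lambda>_. lborel)) ((\<lambda>x. \<lambda>b\<in>B. x \<bullet> b) ` S)"
    by (simp only: meas[OF TS] meas[OF S])
  then show ?thesis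
    unfolding volume_def dimT dirT V Let_def B_def by simp
qed

section \<open>The moment curve\<close>

text \<open>\<open>k\<close> stands for \<open>a - 1\<close>. Allowing it to be smaller than the
  ambient dimension lets one construction serve every \<open>a\<close>; \<open>k = CARD('n)\<close>
  is the full-dimensional case.\<close>

locale orthonormal_frame =
  fixes e :: "nat \<Rightarrow> real ^ 'n" and k :: nat
  assumes k_pos: "0 < k"
    and inner_e: "i \<in> {1..k} \<Longrightarrow> j \<in> {1..k} \<Longrightarrow> e i \<bullet> e j = (if i = j then 1 else 0)"
begin

definition V :: "(real ^ 'n) set" where
  "V = span (e ` {1..k})"

text \<open>The moment curve of degree \<open>k\<close>. Having no constant coordinate, it passes
  through the origin, so its affine hull is a linear subspace.\<close>

definition curve :: "real \<Rightarrow> real ^ 'n" where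
  "curve t = (\<Sum>i=1..k. t ^ i *\<^sub>R e i)"

lemma subspace_V: "subspace V"
  by (simp add: V_def)

lemma e_in_V: "i \<in> {1..k} \<Longrightarrow> e i \<in> V"
  by (auto simp: V_def intro: span_base)

lemma dim_V: "dim V \<le> k"
proof -
  have "dim V \<le> card (e ` {1..k})"
    unfolding V_def by (intro dim_le_card) auto
  also have "\<dots> \<le> k"
    using card_image_le[of "{1..k}" e] by simp
  finally show ?thesis .
qed

lemma curve_in_V: "curve t \<in> V"
  unfolding curve_def
  by (intro subspace_sum subspace_scale subspace_V e_in_V)

lemma curve_0 [simp]: "curve 0 = 0"
  by (auto simp: curve_def intro!: sum.neutral)

lemma curve_inner: "i \<in> {1..k} \<Longrightarrow> curve t \<bullet> e i = t ^ i"
  unfolding curve_def by (intro sum_scaleR_inner_delta) (auto simp: inner_e)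

lemma inj_curve: "inj curve"
proof (rule injI)
  fix s t assume "curve s = curve t"
  then show "s = t"
    using curve_inner[of 1 s] curve_inner[of 1 t] k_pos by simp
qed

lemma card_curve_image: "card (curve ` A) = card A"
  by (rule card_image) (rule inj_on_subset[OF inj_curve subset_UNIV])

text \<open>An affine dependence yields weights that annihilate every polynomial of degree at most
  \<open>k\<close>. Testing them on a polynomial that vanishes at all parameters but one, where the
  weight is nonzero, gives a contradiction.\<close>

lemma affine_independent_curve:
  assumes "finite A" "card A \<le> k + 1"
  shows "\<not> affine_dependent (curve ` A)"
proof
  assume "affine_dependent (curve ` A)"
  then obtain U a where U: "sum U (curve ` A) = 0" "(\<Sum>v\<in>curve ` A. U v *\<^sub>R v) = 0"
    and a: "a \<in> A" "U (curve a) \<noteq> 0"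
    using assms affine_dependent_explicit_finite[of "curve ` A"] by auto
  define c where "c t = U (curve t)" for t
  have inj: "inj_on curve A"
    using inj_curve by (rule inj_on_subset) simp
  have c0: "(\<Sum>t\<in>A. c t) = 0" and c1: "(\<Sum>t\<in>A. c t *\<^sub>R curve t) = 0"
    using U by (simp_all add: sum.reindex[OF inj] c_def)
  \<comment> \<open>The moment of order 0 is the sum of the weights; each other moment is one
    coordinate of the vanishing vector sum.\<close>
  have pow: "(\<Sum>t\<in>A. c t * t ^ i) = 0" if "i \<le> k" for i
  proof (cases "i = 0")
    case False
    then have i: "i \<in> {1..k}" using that by simp
    have "(\<Sum>t\<in>A. c t * t ^ i) = (\<Sum>t\<in>A. c t *\<^sub>R curve t) \<bullet> e i"
      using i by (simp add: inner_sum_left curve_inner)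
    then show ?thesis by (simp add: c1)
  qed (simp add: c0)
  have poly: "(\<Sum>t\<in>A. c t * poly p t) = 0" if "degree p \<le> k" for p
  proof -
    have "(\<Sum>t\<in>A. c t * poly p t) = (\<Sum>t\<in>A. \<Sum>i\<le>degree p. coeff p i * (c t * t ^ i))"
      by (simp add: poly_altdef sum_distrib_left mult_ac)
    also have "\<dots> = (\<Sum>i\<le>degree p. coeff p i * (\<Sum>t\<in>A. c t * t ^ i))"
      by (subst sum.swap) (simp add: sum_distrib_left)
    also have "\<dots> = 0"
      using that by (intro sum.neutral) (simp add: pow)
    finally show ?thesis .
  qed
  \<comment> \<open>There are at most \<open>k + 1\<close> parameters, so leaving out
    \<open>a\<close> keeps the degree within \<open>k\<close>.\<close>
  define p where "p = (\<Prod>t\<in>A - {a}. [:- t, 1:])"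
  have "degree p \<le> (\<Sum>t\<in>A - {a}. degree [:- t, 1:])"
    unfolding p_def using degree_prod_sum_le[of "A - {a}" "\<lambda>t. [:- t, 1:]"] assms(1)
    by (simp add: o_def)
  also have "\<dots> \<le> k"
    using assms a(1) by simp
  finally have "(\<Sum>t\<in>A. c t * poly p t) = 0"
    by (rule poly)
  moreover have "(\<Sum>t\<in>A. c t * poly p t) = c a * poly p a"
  proof -
    have "poly p t = 0" if "t \<in> A - {a}" for t
      using that assms(1) by (auto simp: p_def poly_prod intro!: prod_zero)
    then show ?thesis
      using a(1) assms(1) by (simp add: sum.remove)
  qed
  moreover have "poly p a \<noteq> 0"
    using assms(1) by (auto simp: p_def poly_prod)
  ultimately show False
    using a(2) by (simp add: c_def)
qed

lemma aff_dim_curve: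
  assumes "finite A" "card A = k + 1"
  shows "aff_dim (curve ` A) = int k"
  using aff_dim_affine_independent[OF affine_independent_curve[of A]] assms
  by (simp add: card_curve_image)

lemma span_eq_V:
  assumes "S \<subseteq> V" "k \<le> dim S"
  shows "span S = V"
proof (rule subspace_dim_equal)
  show "span S \<subseteq> V"
    using assms(1) by (rule span_minimal) (rule subspace_V)
qed (use assms(2) dim_V subspace_V in auto)

text \<open>The differences with one fixed point \<open>a\<close> of the simplex already have linear
  dimension \<open>k\<close>, and all differences stay inside \<open>V\<close>, whose dimension is
  at most \<open>k\<close>.\<close>

lemma direction_simplex:
  assumes "finite A" "card A = k + 1"
  shows "direction (convex hull (curve ` A)) = V"
proof -
  let ?S = "convex hull (curve ` A)"
  let ?D = "{x - y | x y. x \<in> ?S \<and> y \<in> ?S}"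
  have SV: "?S \<subseteq> V"
    by (intro hull_minimal subspace_imp_convex subspace_V) (auto simp: curve_in_V)
  obtain a where a: "a \<in> ?S"
    using assms by (metis card.empty convex_hull_eq_empty image_is_empty ex_in_conv add_is_0 one_neq_zero)
  have "int k = int (dim ((+) (- a) ` ?S))"
  proof -
    have "a \<in> affine hull ?S" using a by (rule hull_inc)
    then have "aff_dim ?S = int (dim ((+) (- a) ` ?S))" by (rule aff_dim_eq_dim)
    then show ?thesis using aff_dim_curve[OF assms] by (simp only: aff_dim_convex_hull)
  qed
  moreover have "(+) (- a) ` ?S \<subseteq> ?D"
  proof clarify
    fix x assume "x \<in> ?S"
    then show "\<exists>y z. - a + x = y - z \<and> y \<in> ?S \<and> z \<in> ?S"
      using a by (intro exI[of _ x] exI[of _ a]) simp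
  qed
  ultimately have "k \<le> dim ?D"
    using dim_subset[of "(+) (- a) ` ?S" ?D] by linarith
  moreover have "?D \<subseteq> V"
    using SV subspace_diff[OF subspace_V] by blast
  ultimately show ?thesis
    unfolding direction_def by (intro span_eq_V)
qed

text \<open>\<open>f\<close> is read off from the binomial expansion of \<open>(s - t)\<^sup>i\<close>; it is an involution on \<open>V\<close>
  because the curve spans \<open>V\<close>.\<close>

lemma reflection_exists:
  obtains f where "linear f" "\<And>x. f (f x) = x" "\<And>x. x \<in> V \<Longrightarrow> f x \<in> V"
    "\<And>x. x \<in> orthogonal_comp V \<Longrightarrow> f x = x" "\<And>t. curve s + f (curve t) = curve (s - t)"
proof -
  \<comment> \<open>\<open>m i j\<close> is the coefficient of \<open>t ^ j\<close> in
    \<open>(s - t) ^ i\<close>. The constant coefficient \<open>s ^ i\<close> is a coordinate of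
    \<open>curve s\<close>, so the linear part only takes \<open>j\<close> from 1.\<close>
  define m where "m i j = real (i choose j) * s ^ (i - j) * (- 1) ^ j" for i j
  \<comment> \<open>The added sum replaces the coordinates inside \<open>V\<close>; the component
    orthogonal to \<open>V\<close> is left unchanged.\<close>
  define f where "f x = x + (\<Sum>i=1..k. ((\<Sum>j=1..i. (x \<bullet> e j) * m i j) - x \<bullet> e i) *\<^sub>R e i)" for x
  have lin: "linear f"
    by (rule linearI)
      (simp_all add: f_def inner_add_left distrib_right sum.distrib scaleR_add_left
        scaleR_diff_left sum_subtractf scaleR_sum_right sum_distrib_left mult.assoc
        right_diff_distrib algebra_simps)
  have curve: "curve s + f (curve t) = curve (s - t)" for t
  proof -
    have "f (curve t) = (\<Sum>i=1..k. (\<Sum>j=1..i. t ^ j * m i j) *\<^sub>R e i)"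
    proof -
      have "f (curve t) = curve t + (\<Sum>i=1..k. ((\<Sum>j=1..i. t ^ j * m i j) - t ^ i) *\<^sub>R e i)"
        unfolding f_def by (auto simp: curve_inner intro!: sum.cong)
      then show ?thesis
        by (simp add: curve_def scaleR_diff_left sum_subtractf)
    qed
    moreover have "s ^ i + (\<Sum>j=1..i. t ^ j * m i j) = (s - t) ^ i" for i
    proof -
      have "(s - t) ^ i = (- t + s) ^ i" by simp
      also have "\<dots> = (\<Sum>j\<le>i. t ^ j * m i j)"
        unfolding binomial_ring m_def by (intro sum.cong) (auto simp: power_minus[of t] mult_ac)
      also have "\<dots> = t ^ 0 * m i 0 + (\<Sum>j=1..i. t ^ j * m i j)"
        unfolding atMost_atLeast0 by (subst sum.atLeast_Suc_atMost) auto
      finally show ?thesis by (simp add: m_def)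
    qed
    ultimately show ?thesis
      by (simp add: curve_def sum.distrib[symmetric] scaleR_add_left[symmetric])
  qed
  have comp: "f x = x" if "x \<in> orthogonal_comp V" for x
  proof -
    have "x \<bullet> e i = 0" if "i \<in> {1..k}" for i
      using e_in_V[OF that] \<open>x \<in> orthogonal_comp V\<close>
      by (auto simp: orthogonal_comp_def orthogonal_def inner_commute)
    then show ?thesis by (auto simp: f_def intro!: sum.neutral)
  qed
  have V: "f x \<in> V" if "x \<in> V" for x
    unfolding f_def
    using that by (intro subspace_add subspace_sum subspace_scale subspace_V e_in_V)
  have inv: "f (f x) = x" for x
  proof -
    define U where "U = {x. f (f x) = x}"
    have U: "subspace U"
      using lin by (auto simp: U_def subspace_def linear_add linear_0 linear_scale)
    \<comment> \<open>A second application gives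
      \<open>(curve t - curve s) - (curve 0 - curve s)\<close>, which is \<open>curve t\<close>
      because \<open>curve 0 = 0\<close>.\<close>
    have "f (curve t) = curve (s - t) - curve s" for t
      using curve[of t] by (simp add: algebra_simps)
    then have "curve t \<in> U" for t
      by (simp add: U_def linear_diff[OF lin])
    \<comment> \<open>These are \<open>k + 1\<close> parameters including 0. As the image contains
      the origin, its linear dimension equals its affine dimension \<open>k\<close>.\<close>
    let ?A = "real ` {0..k}"
    have "int (dim (curve ` ?A)) = int k"
    proof -
      have "0 \<in> curve ` ?A" by (force simp: image_iff intro: bexI[of _ 0])
      then show ?thesis
        using aff_dim_zero[of "curve ` ?A"] aff_dim_curve[of ?A]
        by (simp add: hull_inc card_image)
    qed
    then have "V = span (curve ` ?A)"
      by (intro span_eq_V[symmetric]) (auto simp: curve_in_V)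
    also have "\<dots> \<subseteq> U"
      using \<open>\<And>t. curve t \<in> U\<close> U by (intro span_minimal) auto
    finally have "V \<subseteq> U" .
    moreover have "orthogonal_comp V \<subseteq> U"
      by (auto simp: U_def comp)
    ultimately have "V + orthogonal_comp V \<subseteq> U"
      using U by (intro subspace_sum_minimal)
    then show ?thesis
      using subspace_sum_orthogonal_comp[OF subspace_V] by (auto simp: U_def)
  qed
  show thesis
    using that[of f] lin inv V comp curve by blast
qed

text \<open>Affine maps commute with convex hulls, so \<open>x \<mapsto> curve s + f x\<close>
  carries one simplex onto the other.\<close>

lemma volume_reflection:
  assumes "finite A" "card A = k + 1"
  shows "volume k (convex hull (curve ` (\<lambda>t. s - t) ` A)) = volume k (convex hull (curve ` A))"
proof -
  obtain f where f: "linear f" "\<And>x. f (f x) = x" "\<And>x. x \<in> V \<Longrightarrow> f x \<in> V"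
    "\<And>x. x \<in> orthogonal_comp V \<Longrightarrow> f x = x" "\<And>t. curve s + f (curve t) = curve (s - t)"
    by (rule reflection_exists[of s]) blast
  let ?S = "convex hull (curve ` A)"
  have "curve ` (\<lambda>t. s - t) ` A = (+) (curve s) ` (f ` curve ` A)"
    by (simp add: image_image f(5))
  then have "convex hull (curve ` (\<lambda>t. s - t) ` A) = (+) (curve s) ` (f ` ?S)"
    by (simp only: convex_hull_translation convex_hull_linear_image[OF f(1)])
  then have "convex hull (curve ` (\<lambda>t. s - t) ` A) = (\<lambda>x. curve s + f x) ` ?S"
    by (simp only: image_image)
  moreover have "compact ?S"
    using assms by (simp add: finite_imp_compact_convex_hull)
  moreover have "?S \<subseteq> V"
    by (intro hull_minimal subspace_imp_convex subspace_V) (auto simp: curve_in_V)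
  ultimately show ?thesis
    using volume_affine_involution[OF _ _ direction_simplex[OF assms] f(1-4) curve_in_V]
    by simp
qed

text \<open>Among \<open>k + 2\<close> parameters closed under \<open>x \<mapsto> s - x\<close>
  without fixed points, some \<open>k + 1\<close> of them include \<open>u\<close> but not
  \<open>s - u\<close>. Their mirror image contains \<open>s - u\<close>, hence is a different set,
  yet it spans a simplex of the same volume.\<close>

lemma distinct_volumes_card_symmetric:
  assumes J: "finite J" and dist: "distinct_volumes (k + 1) (curve ` J)"
  shows "card {x \<in> J. s - x \<in> J \<and> s - x \<noteq> x} \<le> k + 1"
proof (rule ccontr)
  let ?U = "{x \<in> J. s - x \<in> J \<and> s - x \<noteq> x}"
  assume "\<not> card ?U \<le> k + 1"
  then have cU: "k + 2 \<le> card ?U" by simp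
  have fU: "finite ?U" using J by simp
  obtain u where u: "u \<in> ?U"
    using cU by (metis (no_types, lifting) card.empty ex_in_conv add_is_0 le_zero_eq zero_neq_numeral)
  \<comment> \<open>Removing \<open>u\<close> and its mirror image leaves \<open>k\<close> elements,
    just enough to complete \<open>u\<close> to the vertices of a simplex.\<close>
  have "k \<le> card (?U - {u, s - u})"
    using cU diff_card_le_card_Diff[of "{u, s - u}" ?U] card_insert_le_m1[of 2 "{s - u}" u] by simp
  then obtain A0 where A0: "A0 \<subseteq> ?U - {u, s - u}" "card A0 = k" "finite A0"
    by (rule obtain_subset_with_card_n)
  define A where "A = insert u A0"
  define A' where "A' = (\<lambda>t. s - t) ` A"
  have A: "finite A" "card A = k + 1" "A \<subseteq> J" "s - u \<notin> A"
  proof -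
    have "u \<notin> A0" "s - u \<notin> A0" using A0(1) by auto
    then show "card A = k + 1" "s - u \<notin> A"
      using A0(2,3) u by (simp_all add: A_def)
    show "finite A" "A \<subseteq> J"
      using A0 u by (auto simp: A_def)
  qed
  have A': "card A' = k + 1" "A' \<subseteq> J" "s - u \<in> A'"
  proof -
    show "card A' = k + 1"
      unfolding A'_def using A(2) by (subst card_image) (auto intro: inj_onI)
    show "A' \<subseteq> J" "s - u \<in> A'"
      using A0 u by (auto simp: A'_def A_def)
  qed
  have "volume k (convex hull (curve ` A')) = volume k (convex hull (curve ` A))"
    unfolding A'_def by (rule volume_reflection[OF A(1,2)])
  then have "curve ` A' = curve ` A"
    using A A' by (intro inj_onD[OF dist[unfolded distinct_volumes_def]])
      (auto simp: card_curve_image)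
  then have "A' = A"
    using inj_curve by (simp add: inj_image_eq_iff)
  then show False
    using A(4) A'(3) by simp
qed

end

text \<open>The \<open>t * t - t\<close> ordered pairs of distinct elements are sorted by their sum.
  At most \<open>2 * n\<close> sums occur, each for at most \<open>a\<close> pairs.\<close>

lemma card_le_if_few_symmetric_pairs:
  fixes J :: "real set"
  assumes J: "J \<subseteq> real ` {1..n}"
    and few: "\<And>s. card {x \<in> J. s - x \<in> J \<and> s - x \<noteq> x} \<le> a"
  shows "real (card J) \<le> sqrt (2 * real a * real n) + 1"
proof -
  let ?U = "\<lambda>s. {x \<in> J. s - x \<in> J \<and> s - x \<noteq> x}"
  let ?t = "card J"
  have fin: "finite J" using J by (rule finite_subset) simp
  \<comment> \<open>A pair with sum \<open>s\<close> has the form \<open>(x, s - x)\<close>, so its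
    first entry determines it; being off the diagonal means \<open>s - x \<noteq> x\<close>.\<close>
  have "J \<times> J - (\<lambda>x. (x, x)) ` J \<subseteq> (\<Union>s\<in>real ` {1..2 * n}. (\<lambda>x. (x, s - x)) ` ?U s)"
  proof
    fix p assume "p \<in> J \<times> J - (\<lambda>x. (x, x)) ` J"
    then obtain x y where p: "p = (x, y)" "x \<in> J" "y \<in> J" "x \<noteq> y" by auto
    obtain i j where ij: "x = real i" "y = real j" "i \<in> {1..n}" "j \<in> {1..n}"
      using J p by blast
    then have "x + y \<in> real ` {1..2 * n}"
      by (intro image_eqI[of _ _ "i + j"]) auto
    moreover have "p \<in> (\<lambda>z. (z, (x + y) - z)) ` ?U (x + y)"
      using p by (intro image_eqI[of _ _ x]) auto
    ultimately show "p \<in> (\<Union>s\<in>real ` {1..2 * n}. (\<lambda>x. (x, s - x)) ` ?U s)" by blast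
  qed
  then have "card (J \<times> J - (\<lambda>x. (x, x)) ` J)
      \<le> card (\<Union>s\<in>real ` {1..2 * n}. (\<lambda>x. (x, s - x)) ` ?U s)"
    using fin by (intro card_mono) auto
  also have "\<dots> \<le> (\<Sum>s\<in>real ` {1..2 * n}. card ((\<lambda>x. (x, s - x)) ` ?U s))"
    by (rule card_UN_le) simp
  also have "\<dots> \<le> (\<Sum>s\<in>real ` {1..2 * n}. a)"
    using fin few by (intro sum_mono order_trans[OF card_image_le]) auto
  also have "\<dots> = 2 * n * a"
    by (simp add: card_image)
  also have "card (J \<times> J - (\<lambda>x. (x, x)) ` J) = ?t * ?t - ?t"
    using fin by (subst card_Diff_subset) (auto simp: card_cartesian_product card_image inj_on_def)
  finally have le: "?t * ?t \<le> 2 * n * a + ?t" by simp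
  show ?thesis
  proof (cases "?t = 0")
    case False
    have "real ?t * real ?t \<le> 2 * real n * real a + real ?t"
      using le by (metis of_nat_add of_nat_le_iff of_nat_mult of_nat_numeral)
    \<comment> \<open>The square is \<open>?t * ?t - ?t\<close> minus \<open>?t - 1\<close>, and the
      latter is nonnegative only because \<open>?t\<close> is at least 1; hence the case
      distinction.\<close>
    then have "(real ?t - 1)\<^sup>2 \<le> 2 * real a * real n"
      using False by (simp add: power2_eq_square algebra_simps)
    then have "real ?t - 1 \<le> sqrt (2 * real a * real n)"
      by (rule real_le_rsqrt)
    then show ?thesis by simp
  qed simp
qed

section \<open>Point sets on the moment curve\<close>

context orthonormal_frame
begin

lemma card_distinct_volumes_le:
  assumes "Q \<subseteq> curve ` real ` {1..n}" "distinct_volumes (k + 1) Q"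
  shows "real (card Q) \<le> sqrt (2 * real (k + 1) * real n) + 1"
proof -
  obtain J where J: "J \<subseteq> real ` {1..n}" "Q = curve ` J"
    using assms(1) by (meson subset_imageE)
  have "finite J" using J(1) by (rule finite_subset) simp
  then show ?thesis
    using card_le_if_few_symmetric_pairs[OF J(1) distinct_volumes_card_symmetric[of J]] assms(2) J(2)
    by (simp add: card_curve_image)
qed

lemma aff_dim_curve_subset:
  assumes "A \<subseteq> range curve" "card A = k + 1"
  shows "aff_dim A = int k"
proof -
  obtain A0 where A0: "A = curve ` A0"
    using assms(1) by (meson subset_imageE)
  then have "card A0 = k + 1" using assms(2) by (simp add: card_curve_image)
  moreover from this have "finite A0" by (metis add_is_0 card.infinite one_neq_zero)
  ultimately show ?thesis using aff_dim_curve A0 by simp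
qed

lemma no_points_on_flat_curve:
  assumes "P \<subseteq> range curve"
  shows "no_points_on_flat (k + 1) P"
  unfolding no_points_on_flat_def
proof
  assume "\<exists>A F. A \<subseteq> P \<and> card A = k + 1 \<and> is_flat (k + 1 - 2) F \<and> A \<subseteq> F"
  then obtain A F where A: "A \<subseteq> P" "card A = k + 1" "is_flat (k + 1 - 2) F" "A \<subseteq> F"
    by blast
  then have "int k \<le> aff_dim F"
    using aff_dim_curve_subset[of A] assms aff_dim_subset[of A F] by auto
  \<comment> \<open>The subtraction in \<open>k + 1 - 2\<close> is truncated; by
    \<open>k_pos\<close> it has the intended value \<open>k - 1\<close>, which is below
    \<open>k\<close>.\<close>
  then show False
    using A(3) k_pos by (auto simp: is_flat_def)
qed

lemma general_position_curve:
  assumes "P \<subseteq> range curve" "k = CARD('n)" "finite P" "CARD('n) + 1 \<le> card P"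
  shows "general_position P"
proof -
  have False if A: "A \<subseteq> P" "card A = k + 1" "is_hyperplane F" "A \<subseteq> F" for A F
  proof -
    have "aff_dim F = int CARD('n) - 1"
      using A(3) by (auto simp: is_hyperplane_def)
    moreover have "int k \<le> aff_dim F"
      using aff_dim_curve_subset[of A] assms(1) A aff_dim_subset[of A F] by auto
    ultimately show False using assms(2) by simp
  qed
  then show ?thesis
    using assms by (auto simp: general_position_def)
qed

end

section \<open>The upper bounds\<close>

lemma orthonormal_frame_exists:
  assumes "0 < k" "k \<le> CARD('n)"
  obtains e :: "nat \<Rightarrow> real ^ 'n" where "orthonormal_frame e k"
proof -
  obtain e :: "nat \<Rightarrow> real ^ 'n" where e: "e ` {1..k} \<subseteq> Basis" "inj_on e {1..k}"
    using card_le_inj[of "{1..k}" "Basis :: (real ^ 'n) set"] assms by auto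
  have "orthonormal_frame e k"
  proof
    fix i j assume ij: "i \<in> {1..k}" "j \<in> {1..k}"
    then have "e i \<in> Basis" "e j \<in> Basis" "e i = e j \<longleftrightarrow> i = j"
      using e by (auto dest: inj_onD)
    then show "e i \<bullet> e j = (if i = j then 1 else 0)"
      by (simp add: inner_Basis)
  qed (rule assms(1))
  then show thesis by (rule that)
qed

lemma distinct_volumes_empty: "0 < a \<Longrightarrow> distinct_volumes a {}"
  by (auto simp: distinct_volumes_def inj_on_def)

text \<open>\<open>GREATEST\<close> is itself an admissible value once some value is admissible and
  all are bounded: \<open>P 0\<close> supplies the first, rounding \<open>b\<close> down the
  second.\<close>

lemma Greatest_le_real:
  fixes P :: "nat \<Rightarrow> bool"
  assumes "P 0" "\<And>t. P t \<Longrightarrow> real t \<le> b"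
  shows "real (GREATEST t. P t) \<le> b"
proof -
  have "t \<le> nat \<lfloor>b\<rfloor>" if "P t" for t
    using assms(2)[OF that] by linarith
  then have "P (GREATEST t. P t)"
    using assms(1) by (rule GreatestI_nat[rotated])
  then show ?thesis by (rule assms(2))
qed

text \<open>An admissible \<open>t\<close> must work for every point set, in particular for the
  points of the moment curve with parameters 1 to \<open>n\<close>.\<close>

lemma H_flat_le:
  assumes "2 \<le> a" "a \<le> CARD('d::finite) + 1"
  shows "real (H_flat TYPE('d) a n) \<le> sqrt (2 * real a * real n) + 1"
proof -
  obtain k where k: "a = k + 1" "0 < k" "k \<le> CARD('d)"
    using assms by (cases a) auto
  obtain e :: "nat \<Rightarrow> real ^ 'd" where "orthonormal_frame e k"
    using orthonormal_frame_exists[OF k(2,3)] by blast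
  then interpret orthonormal_frame e k .
  let ?P = "curve ` real ` {1..n}"
  have P: "finite ?P" "card ?P = n" "no_points_on_flat a ?P"
    unfolding k(1)
    by (simp, simp add: card_curve_image card_image, rule no_points_on_flat_curve, blast)
  show ?thesis
    unfolding H_flat_def
  proof (rule Greatest_le_real)
    show "\<forall>P::(real ^ 'd) set. finite P \<and> card P = n \<and> no_points_on_flat a P \<longrightarrow>
        (\<exists>Q\<subseteq>P. card Q = 0 \<and> distinct_volumes a Q)"
      using distinct_volumes_empty[of a] k(1) by (metis add_gr_0 card.empty empty_subsetI zero_less_one)
  next
    fix t assume "\<forall>P::(real ^ 'd) set. finite P \<and> card P = n \<and> no_points_on_flat a P \<longrightarrow>
        (\<exists>Q\<subseteq>P. card Q = t \<and> distinct_volumes a Q)"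
    then obtain Q where "Q \<subseteq> ?P" "card Q = t" "distinct_volumes a Q"
      using P by blast
    then show "real t \<le> sqrt (2 * real a * real n) + 1"
      using card_distinct_volumes_le[of Q n] k(1) by simp
  qed
qed

text \<open>The same witness with \<open>k = CARD('d)\<close>; the lower bound on \<open>n\<close>
  supplies the number of points that general position demands.\<close>

lemma H_general_le:
  assumes "CARD('d::finite) + 1 \<le> n"
  shows "real (H_general TYPE('d) n) \<le> sqrt (2 * (real CARD('d) + 1) * real n) + 1"
proof -
  obtain e :: "nat \<Rightarrow> real ^ 'd" where "orthonormal_frame e CARD('d)"
    using orthonormal_frame_exists[of "CARD('d)"] by auto
  then interpret orthonormal_frame e "CARD('d)" .
  let ?P = "curve ` real ` {1..n}"
  have card: "card ?P = n" by (simp add: card_curve_image card_image)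
  have P: "general_position ?P"
    by (rule general_position_curve) (use assms card in auto)
  show ?thesis
    unfolding H_general_def
  proof (rule Greatest_le_real)
    show "\<forall>P::(real ^ 'd) set. card P = n \<and> general_position P \<longrightarrow>
        (\<exists>Q\<subseteq>P. card Q = 0 \<and> distinct_volumes (CARD('d) + 1) Q)"
      using distinct_volumes_empty[of "CARD('d) + 1"] by (metis add_gr_0 card.empty empty_subsetI zero_less_one)
  next
    fix t assume "\<forall>P::(real ^ 'd) set. card P = n \<and> general_position P \<longrightarrow>
        (\<exists>Q\<subseteq>P. card Q = t \<and> distinct_volumes (CARD('d) + 1) Q)"
    then obtain Q where "Q \<subseteq> ?P" "card Q = t" "distinct_volumes (CARD('d) + 1) Q"
      using P card by blast
    then show "real t \<le> sqrt (2 * (real CARD('d) + 1) * real n) + 1"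
      using card_distinct_volumes_le[of Q n] by (simp add: add.commute)
  qed
qed

text \<open>The additive 1 is absorbed as a relative error \<open>1 / sqrt (c * real n)\<close>,
  which tends to 0; \<open>0 < N\<close> keeps the root nonzero in the relevant range.\<close>

lemma asymptotic_bound:
  fixes H :: "nat \<Rightarrow> real"
  assumes "0 < c" "0 < N" "\<And>n. N \<le> n \<Longrightarrow> H n \<le> sqrt (c * real n) + 1"
  shows "\<exists>\<epsilon>. \<epsilon> \<longlonglongrightarrow> 0 \<and> (\<forall>n\<ge>N. H n \<le> (1 + \<epsilon> n) * sqrt (c * real n))"
proof (intro exI[of _ "\<lambda>n. 1 / sqrt (c * real n)"] conjI allI impI)
  have "filterlim (\<lambda>n. sqrt (c * real n)) at_top sequentially"
    using assms(1)
    by (intro filterlim_compose[OF sqrt_at_top] filterlim_tendsto_pos_mult_at_top[OF tendsto_const]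
        filterlim_real_sequentially)
  then show "(\<lambda>n. 1 / sqrt (c * real n)) \<longlonglongrightarrow> 0"
    by (intro tendsto_divide_0[OF tendsto_const] filterlim_at_top_imp_at_infinity)
next
  fix n assume n: "N \<le> n"
  have "sqrt (c * real n) \<noteq> 0"
    using n assms(1,2) by simp
  then have "(1 + 1 / sqrt (c * real n)) * sqrt (c * real n) = sqrt (c * real n) + 1"
    by (simp add: field_simps)
  then show "H n \<le> (1 + 1 / sqrt (c * real n)) * sqrt (c * real n)"
    using assms(3)[OF n] by simp
qed

theorem theorem1:
  shows "(\<forall>a::nat. 2 \<le> a \<and> a \<le> CARD('d::finite) + 1 \<longrightarrow>
            (\<exists>\<epsilon>::nat \<Rightarrow> real. \<epsilon> \<longlonglongrightarrow> 0 \<and>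
              (\<forall>n\<ge>2 * a. real (H_flat TYPE('d) a n)
                 \<le> (1 + \<epsilon> n) * sqrt (2 * real a * real n)))) \<and>
         (\<exists>\<epsilon>::nat \<Rightarrow> real. \<epsilon> \<longlonglongrightarrow> 0 \<and>
            (\<forall>n\<ge>2 * (CARD('d) + 1). real (H_general TYPE('d) n)
               \<le> (1 + \<epsilon> n) * sqrt (2 * (real CARD('d) + 1) * real n)))"
proof (intro conjI allI impI)
  fix a :: nat assume "2 \<le> a \<and> a \<le> CARD('d) + 1"
  then show "\<exists>\<epsilon>::nat \<Rightarrow> real. \<epsilon> \<longlonglongrightarrow> 0 \<and>
      (\<forall>n\<ge>2 * a. real (H_flat TYPE('d) a n) \<le> (1 + \<epsilon> n) * sqrt (2 * real a * real n))"
    by (intro asymptotic_bound H_flat_le) auto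
next
  show "\<exists>\<epsilon>::nat \<Rightarrow> real. \<epsilon> \<longlonglongrightarrow> 0 \<and>
      (\<forall>n\<ge>2 * (CARD('d) + 1). real (H_general TYPE('d) n)
         \<le> (1 + \<epsilon> n) * sqrt (2 * (real CARD('d) + 1) * real n))"
    \<comment> \<open>Here \<open>n\<close> is at least twice \<open>CARD('d) + 1\<close>, which is
      more than general position asks for.\<close>
    by (intro asymptotic_bound H_general_le) (auto simp: add_pos_nonneg)
qed

end
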